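(* Let $\beta\in(-1,1)$, $\mu_->0$ and $\mu_+<0$, and let $p(t;x,y)$ be the transition density (the density in $y$ of $X_t$ given $X_0=x$) of the refracted skew Brownian motion $X$ with parameters $(\beta,\mu_+,\mu_-)$ and skew level $a=0$. Then for any $x\in\mathbb{R}$, $$\lim_{t\to\infty}p(t;x,y)=\begin{cases}\dfrac{-2(1+\beta)\mu_+\mu_-}{(1+\beta)\mu_--(1-\beta)\mu_+}\,e^{2\mu_+y}, & y>0,\\[3mm] \dfrac{-2(1-\beta)\mu_+\mu_-}{(1+\beta)\mu_--(1-\beta)\mu_+}\,e^{2\mu_-y}, & y<0.\end{cases}$$
   Context: The refracted skew Brownian motion with parameters $\beta\in(-1,1)$, $\mu_+,\mu_-\in\mathbb{R}$ and skew level $a\in\mathbb{R}$ is the pathwise unique (strong) solution $X$ of $$X_t=X_0+B_t+\beta L^X(t,a)+\mu_+\int_0^t \mathbf{1}_{\{X_s>a\}}\,\mathrm{d}s+\mu_-\int_0^t\mathbf{1}_{\{X_s<a\}}\,\mathrm{d}s,\qquad t\ge 0,$$ where $B$ is a standard Brownian motion and $L^X(t,a)=\lim_{\epsilon\to0^+}\frac{1}{2\epsilon}\mathrm{Leb}(\{s\le t:|X_s-a|\le\epsilon\})$ is the symmetric local time of $X$ at level $a$. For skew level $a=0$, the density $p(t;x,y)$, $t>0$, $x\in\mathbb{R}$, $y\neq0$, is taken to be the version given by the following explicit formulas, with $h(s;x,\mu)=\frac{|x|}{\sqrt{2\pi s^3}}e^{-(x+\mu s)^2/(2s)}$ and $\phi(z;\mu)=\frac{1}{\sqrt{2\pi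 t}}e^{-(z-\mu t)^2/(2t)}$. For $y>0$: if $x\ge0$, $p(t;x,y)=\phi(y-x;\mu_+)-e^{-2\mu_+x}\phi(x+y;\mu_+)+2(1+\beta)e^{2\mu_+y}\int_0^\infty\int_0^t h(t-\tau;(1+\beta)b+x+y,\mu_+)h(\tau;(1-\beta)b,-\mu_-)\,\mathrm{d}\tau\,\mathrm{d}b$; if $x<0$, $p(t;x,y)=2(1+\beta)e^{2\mu_+y}\int_0^\infty\int_0^t h(\tau;(1+\beta)b+y,\mu_+)h(t-\tau;(1-\beta)b-x,-\mu_-)\,\mathrm{d}\tau\,\mathrm{d}b$. For $y<0$: if $x>0$, $p(t;x,y)=2(1-\beta)e^{2\mu_-y}\int_0^\infty\int_0^t h(t-\tau;(1+\beta)b+x,\mu_+)h(\tau;(1-\beta)b-y,-\mu_-)\,\mathrm{d}\tau\,\mathrm{d}b$; if $x\le0$, $p(t;x,y)=\phi(y-x;\mu_-)-e^{2\mu_-y}\phi(-x-y;\mu_-)+2(1-\beta)e^{2\mu_-y}\int_0^\infty\int_0^t h(\tau;(1+\beta)b,\mu_+)h(t-\tau;(1-\beta)b-y-x,-\mu_-)\,\mathrm{d}\tau\,\mathrm{d}b$. *)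

theory Defs
  imports "HOL-Probability.Probability"
begin

text \<open>Time ranges over \<open>{0..}\<close>; processes and filtrations are indexed by \<^typ>\<open>real\<close> and their
  values at negative times are irrelevant.\<close>

definition filtration_on :: "'w measure \<Rightarrow> (real \<Rightarrow> 'w measure) \<Rightarrow> bool" where
  "filtration_on M F \<longleftrightarrow>
     (\<forall>t\<ge>0. subalgebra M (F t)) \<and> (\<forall>s\<ge>0. \<forall>t\<ge>s. subalgebra (F t) (F s))"

definition brownian_motion ::
    "'w measure \<Rightarrow> (real \<Rightarrow> 'w measure) \<Rightarrow> (real \<Rightarrow> 'w \<Rightarrow> real) \<Rightarrow> bool" where
  "brownian_motion M F B \<longleftrightarrow>
     prob_space M \<and> filtration_on M F \<and>
     (\<forall>t\<ge>0. B t \<in> borel_measurable (F t)) \<and>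
     (AE \<omega> in M. B 0 \<omega> = 0) \<and>
     (AE \<omega> in M. continuous_on {0..} (\<lambda>t. B t \<omega>)) \<and>
     (\<forall>s\<ge>0. \<forall>t>s.
        distributed M lborel (\<lambda>\<omega>. B t \<omega> - B s \<omega>) (\<lambda>z. ennreal (normal_density 0 (sqrt (t - s)) z)) \<and>
        prob_space.indep_set M (sets (F s))
          (sets (vimage_algebra (space M) (\<lambda>\<omega>. B t \<omega> - B s \<omega>) borel)))"

definition occupation_quotient :: "(real \<Rightarrow> real) \<Rightarrow> real \<Rightarrow> real \<Rightarrow> real \<Rightarrow> real" where
  "occupation_quotient f t a \<epsilon> =
     measure lborel {s. 0 \<le> s \<and> s \<le> t \<and> \<bar>f s - a\<bar> \<le> \<epsilon>} / (2 * \<epsilon>)"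

text \<open>Meaningful only for paths \<open>f\<close> along which the limit exists; existence is part of the
  notion of solution below.\<close>

definition symmetric_local_time :: "(real \<Rightarrow> real) \<Rightarrow> real \<Rightarrow> real \<Rightarrow> real" where
  "symmetric_local_time f t a = Lim (at_right 0) (occupation_quotient f t a)"

text \<open>The adaptedness of \<open>X\<close> is with respect to an arbitrary filtration for which \<open>B\<close> is a
  Brownian motion. As the equation has a pathwise unique strong solution, this describes
  the same process as requiring \<open>X\<close> to be adapted to the completed filtration generated by \<open>X 0\<close>
  and \<open>B\<close>.\<close>

definition refracted_skew_bm ::
    "'w measure \<Rightarrow> (real \<Rightarrow> 'w measure) \<Rightarrow> (real \<Rightarrow> 'w \<Rightarrow> real) \<Rightarrow>
     real \<Rightarrow> real \<Rightarrow> real \<Rightarrow> real \<Rightarrow> (real \<Rightarrow> 'w \<Rightarrow> real) \<Rightarrow> bool" where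
  "refracted_skew_bm M F B \<beta> \<mu>p \<mu>m a X \<longleftrightarrow>
     brownian_motion M F B \<and>
     (\<forall>t\<ge>0. X t \<in> borel_measurable (F t)) \<and>
     (AE \<omega> in M. continuous_on {0..} (\<lambda>t. X t \<omega>)) \<and>
     (AE \<omega> in M. \<forall>t\<ge>0.
        (\<exists>l. (occupation_quotient (\<lambda>s. X s \<omega>) t a \<longlongrightarrow> l) (at_right 0)) \<and>
        X t \<omega> = X 0 \<omega> + B t \<omega> + \<beta> * symmetric_local_time (\<lambda>s. X s \<omega>) t a
               + \<mu>p * (LINT s:{0..t}|lborel. indicator {a<..} (X s \<omega>))
               + \<mu>m * (LINT s:{0..t}|lborel. indicator {..<a} (X s \<omega>)))"

text \<open>\<open>hit_density s x \<mu>\<close> is, for \<open>s > 0\<close>, the density at \<open>s\<close> of the first hitting time of \<open>0\<close> by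
  Brownian motion with drift \<open>\<mu>\<close> started at \<open>x\<close>. At \<open>s = 0\<close> it has the value \<open>0\<close>.\<close>

definition hit_density :: "real \<Rightarrow> real \<Rightarrow> real \<Rightarrow> real" where
  "hit_density s x \<mu> = \<bar>x\<bar> / sqrt (2 * pi * s ^ 3) * exp (- (x + \<mu> * s)\<^sup>2 / (2 * s))"

definition drift_kernel :: "real \<Rightarrow> real \<Rightarrow> real \<Rightarrow> real" where
  "drift_kernel t z \<mu> = 1 / sqrt (2 * pi * t) * exp (- (z - \<mu> * t)\<^sup>2 / (2 * t))"

text \<open>The version of the transition density for skew level \<open>0\<close>, to be used for \<open>t > 0\<close> and
  \<open>y \<noteq> 0\<close> only.\<close>

definition rsbm_density :: "real \<Rightarrow> real \<Rightarrow> real \<Rightarrow> real \<Rightarrow> real \<Rightarrow> real \<Rightarrow> real" where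
  "rsbm_density \<beta> \<mu>p \<mu>m t x y =
    (if y > 0 then
       (if x \<ge> 0 then
          drift_kernel t (y - x) \<mu>p - exp (- 2 * \<mu>p * x) * drift_kernel t (x + y) \<mu>p
          + 2 * (1 + \<beta>) * exp (2 * \<mu>p * y) *
            (LINT b:{0..}|lborel. LINT \<tau>:{0..t}|lborel.
               hit_density (t - \<tau>) ((1 + \<beta>) * b + x + y) \<mu>p * hit_density \<tau> ((1 - \<beta>) * b) (- \<mu>m))
        else
          2 * (1 + \<beta>) * exp (2 * \<mu>p * y) *
            (LINT b:{0..}|lborel. LINT \<tau>:{0..t}|lborel.
               hit_density \<tau> ((1 + \<beta>) * b + y) \<mu>p * hit_density (t - \<tau>) ((1 - \<beta>) * b - x) (- \<mu>m)))
     else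
       (if x > 0 then
          2 * (1 - \<beta>) * exp (2 * \<mu>m * y) *
            (LINT b:{0..}|lborel. LINT \<tau>:{0..t}|lborel.
               hit_density (t - \<tau>) ((1 + \<beta>) * b + x) \<mu>p * hit_density \<tau> ((1 - \<beta>) * b - y) (- \<mu>m))
        else
          drift_kernel t (y - x) \<mu>m - exp (2 * \<mu>m * y) * drift_kernel t (- x - y) \<mu>m
          + 2 * (1 - \<beta>) * exp (2 * \<mu>m * y) *
            (LINT b:{0..}|lborel. LINT \<tau>:{0..t}|lborel.
               hit_density \<tau> ((1 + \<beta>) * b) \<mu>p * hit_density (t - \<tau>) ((1 - \<beta>) * b - y - x) (- \<mu>m))))"

end

theory Submission
  imports Defs "HOL-Real_Asymp.Real_Asymp"
begin

text \<open>The drifts point towards \<open>0\<close> from both sides, so the hitting densities in the explicit formula are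
genuine probability densities: a Brownian motion with drift \<open>-m\<close>, \<open>m > 0\<close>, started at \<open>u > 0\<close>
reaches \<open>0\<close> at a time of mean \<open>u / m\<close> and variance of order \<open>u\<close>. For fixed \<open>b\<close> the inner convolution
is therefore the density at \<open>t\<close> of the sum of two independent hitting times, started at \<open>A * b + p\<close>
and \<open>B * b + q\<close> with drifts \<open>-m\<close> and \<open>-n\<close>. As \<open>b\<close> grows this sum performs a process with independent
increments whose mean rate is \<open>A / m + B / n\<close>, and the integral over \<open>b\<close> is its renewal density. By
the renewal principle it converges to the reciprocal rate \<open>m * n / (A * n + B * m)\<close>. The Gaussian
kernels in the formula are at most of order \<open>1 / sqrt t\<close>, and multiplying the renewal limit by the explicit
prefactors gives the claim.

The renewal limit is proved by Laplace's method instead of a general renewal theorem, because a limit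
of the density itself is needed. Write \<open>s\<close> and \<open>t - s\<close> for the two hitting times. On the event
that both are a positive fraction of \<open>t\<close>, use the normalised fluctuations
\<open>X = (u - m * s) / sqrt t\<close> and \<open>Y = (v - n * (t - s)) / sqrt t\<close>, with \<open>u = A * b + p\<close> and
\<open>v = B * b + q\<close>, as coordinates in place of \<open>(b, s)\<close>. The map is affine with Jacobian
\<open>t / (A * n + B * m)\<close>. In these coordinates the integrand tends to the constant
\<open>m * n / (A * n + B * m)\<close> times the product of two centred normal densities, and it stays below a fixed
integrable function because \<open>s\<close> and \<open>t - s\<close> lie between a fixed fraction of \<open>t\<close> and \<open>t\<close>; this is \<open>typical_region_tendsto\<close>.
When \<open>s\<close> or \<open>t - s\<close> is a smaller fraction of \<open>t\<close> than it should be, the two deviations \<open>u - m * s\<close>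
and \<open>v - n * (t - s)\<close> cannot both be small, so the exponent is at least of order \<open>t\<close> and beats the
polynomial prefactors; this is \<open>atypical_region_tendsto_0\<close>. Adding the pieces yields
\<open>two_sided_renewal_tendsto\<close>.\<close>

section \<open>Gaussian integrals and affine coordinates in the plane\<close>

text \<open>Tonelli reduces a triangular affine substitution to two one-dimensional ones: first \<open>b\<close> is replaced
at fixed \<open>s\<close>, then \<open>s\<close> at fixed \<open>X\<close>. The coordinates adapted to the deviations of two hitting
times have this form.\<close>

lemma nn_integral_plane_shear:
  fixes f :: "real \<times> real \<Rightarrow> ennreal" and a c k l d e :: real
  assumes f [measurable]: "f \<in> borel_measurable borel" and a: "a \<noteq> 0" and c: "c \<noteq> 0"
  shows "(\<integral>\<^sup>+s. \<integral>\<^sup>+b. f (b, s) \<partial>lborel \<partial>lborel) =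
    ennreal (\<bar>a\<bar> * \<bar>c\<bar>) * (\<integral>\<^sup>+X. \<integral>\<^sup>+Y. f (l + k * (e + d * X + c * Y) + a * X, e + d * X + c * Y) \<partial>lborel \<partial>lborel)"
proof -
  have "(\<integral>\<^sup>+s. \<integral>\<^sup>+b. f (b, s) \<partial>lborel \<partial>lborel)
      = (\<integral>\<^sup>+s. ennreal \<bar>a\<bar> * (\<integral>\<^sup>+X. f (l + k * s + a * X, s) \<partial>lborel) \<partial>lborel)"
  proof (rule nn_integral_cong)
    fix s :: real
    have "(\<lambda>b. f (b, s)) \<in> borel_measurable borel" by measurable
    from nn_integral_real_affine[OF this a, of "l + k * s"]
    show "(\<integral>\<^sup>+b. f (b, s) \<partial>lborel) = ennreal \<bar>a\<bar> * (\<integral>\<^sup>+X. f (l + k * s + a * X, s) \<partial>lborel)"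
      by simp
  qed
  also have "\<dots> = ennreal \<bar>a\<bar> * (\<integral>\<^sup>+s. \<integral>\<^sup>+X. f (l + k * s + a * X, s) \<partial>lborel \<partial>lborel)"
    by (rule nn_integral_cmult) measurable
  also have "(\<integral>\<^sup>+s. \<integral>\<^sup>+X. f (l + k * s + a * X, s) \<partial>lborel \<partial>lborel)
     = (\<integral>\<^sup>+X. \<integral>\<^sup>+s. f (l + k * s + a * X, s) \<partial>lborel \<partial>lborel)"
    by (rule lborel_pair.Fubini') measurable
  also have "\<dots> = (\<integral>\<^sup>+X. ennreal \<bar>c\<bar> * (\<integral>\<^sup>+Y. f (l + k * (e + d * X + c * Y) + a * X, e + d * X + c * Y) \<partial>lborel) \<partial>lborel)"
  proof (rule nn_integral_cong)
    fix X :: real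
    have "(\<lambda>s. f (l + k * s + a * X, s)) \<in> borel_measurable borel" by measurable
    from nn_integral_real_affine[OF this c, of "e + d * X"]
    show "(\<integral>\<^sup>+s. f (l + k * s + a * X, s) \<partial>lborel) = ennreal \<bar>c\<bar> * (\<integral>\<^sup>+Y. f (l + k * (e + d * X + c * Y) + a * X, e + d * X + c * Y) \<partial>lborel)"
      by simp
  qed
  also have "\<dots> = ennreal \<bar>c\<bar> * (\<integral>\<^sup>+X. \<integral>\<^sup>+Y. f (l + k * (e + d * X + c * Y) + a * X, e + d * X + c * Y) \<partial>lborel \<partial>lborel)"
    by (rule nn_integral_cmult) measurable
  finally show ?thesis by (simp add: ennreal_mult mult.assoc)
qed

lemma integral_tensor_product:
  fixes f g :: "real \<Rightarrow> real"
  assumes f: "integrable lborel f" and g: "integrable lborel g"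
  shows "integrable (lborel \<Otimes>\<^sub>M lborel) (\<lambda>z. f (fst z) * g (snd z))"
    and "(\<integral>z. f (fst z) * g (snd z) \<partial>(lborel \<Otimes>\<^sub>M lborel)) = (\<integral>x. f x \<partial>lborel) * (\<integral>y. g y \<partial>lborel)"
proof -
  have [measurable]: "f \<in> borel_measurable borel" "g \<in> borel_measurable borel"
    using f g by (auto dest: borel_measurable_integrable)
  show *: "integrable (lborel \<Otimes>\<^sub>M lborel) (\<lambda>z. f (fst z) * g (snd z))"
    by (rule lborel_pair.Fubini_integrable) (use f g in \<open>auto simp: abs_mult\<close>)
  show "(\<integral>z. f (fst z) * g (snd z) \<partial>(lborel \<Otimes>\<^sub>M lborel)) = (\<integral>x. f x \<partial>lborel) * (\<integral>y. g y \<partial>lborel)"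
    using lborel_pair.integral_fst'[OF *] by simp
qed

lemma integrable_abs_std_normal_density:
  "integrable lborel (\<lambda>x. (\<bar>x\<bar> + c) * std_normal_density x)"
proof -
  have "integrable lborel (\<lambda>x. std_normal_density x * \<bar>x\<bar> ^ 1)"
    by (rule integrable_std_normal_moment_abs)
  moreover have "integrable lborel (\<lambda>x. c * std_normal_density x)"
    using integrable_std_normal_moment[of 0] by simp
  ultimately have "integrable lborel (\<lambda>x. std_normal_density x * \<bar>x\<bar> ^ 1 + c * std_normal_density x)"
    by (rule Bochner_Integration.integrable_add)
  then show ?thesis by (simp add: algebra_simps)
qed

lemma integrable_gaussian_tail_weight:
  "integrable lborel (\<lambda>z. (1 + \<bar>z\<bar>)\<^sup>2 * normal_density 0 (sqrt 2) z)"
proof -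
  have "integrable lborel (\<lambda>z. normal_density 0 (sqrt 2) z * \<bar>z - 0\<bar> ^ k)" for k
    by (rule integrable_normal_moment_abs) simp
  note m = this[of 0] this[of 1] this[of 2]
  have "integrable lborel (\<lambda>z. normal_density 0 (sqrt 2) z * \<bar>z - 0\<bar> ^ 0
      + 2 * (normal_density 0 (sqrt 2) z * \<bar>z - 0\<bar> ^ 1) + normal_density 0 (sqrt 2) z * \<bar>z - 0\<bar> ^ 2)"
    by (intro Bochner_Integration.integrable_add integrable_mult_right m)
  then show ?thesis by (simp add: power2_eq_square algebra_simps)
qed

text \<open>A variance that ranges over \<open>{\<delta>..1}\<close> costs only the constant \<open>1 / sqrt \<delta>\<close>, with a bound that does
not depend on the variance. This provides the dominating function for the typical region.\<close>

lemma normal_density_le_std: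
  assumes "\<delta> \<le> r" "r \<le> 1" "0 < \<delta>"
  shows "normal_density 0 (sqrt r) x \<le> 1 / sqrt \<delta> * std_normal_density x"
proof -
  have "1 / sqrt r \<le> 1 / sqrt \<delta>"
    using assms by (intro divide_left_mono) (auto intro: mult_pos_pos)
  moreover have "x\<^sup>2 \<le> x\<^sup>2 / r"
    using assms mult_right_mono[of r 1 "x\<^sup>2"] by (simp add: field_simps)
  then have "exp (- x\<^sup>2 / (2 * r)) \<le> exp (- x\<^sup>2 / 2)"
    by (simp add: field_simps)
  ultimately have "1 / sqrt r * exp (- x\<^sup>2 / (2 * r)) \<le> 1 / sqrt \<delta> * exp (- x\<^sup>2 / 2)"
    by (rule mult_mono) (use assms in auto)
  then have "1 / sqrt (2 * pi) * (1 / sqrt r * exp (- x\<^sup>2 / (2 * r))) \<le> 1 / sqrt (2 * pi) * (1 / sqrt \<delta> * exp (- x\<^sup>2 / 2))"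
    by (rule mult_left_mono) simp
  then show ?thesis
    using assms by (simp add: normal_density_def real_sqrt_mult ac_simps)
qed

lemma normal_density_scale:
  assumes "s > 0" "t > 0"
  shows "sqrt t * normal_density 0 (sqrt s) (sqrt t * X) = normal_density 0 (sqrt (s / t)) X"
  using assms by (simp add: normal_density_def power_mult_distrib real_sqrt_divide real_sqrt_mult field_simps)

lemma nn_integral_inverse_sqrt:
  assumes "0 \<le> t"
  shows "(\<integral>\<^sup>+s. ennreal (indicator {0..t} s * (s powr (- (1/2)) + 1)) \<partial>lborel) = ennreal (2 * sqrt t + t)"
proof (rule nn_integral_has_integral_lborel)
  have "((\<lambda>s. s powr (- (1/2)) + 1) has_integral (t powr (- (1/2) + 1) / (- (1/2) + 1) + t)) {0..t}"
    using has_integral_add[OF has_integral_powr_from_0[of "- (1/2)" t] has_integral_const_real[of 1 0 t]] assms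
    by simp
  then have "((\<lambda>s. s powr (- (1/2)) + 1) has_integral (2 * sqrt t + t)) {0..t}"
    using assms by (simp add: powr_half_sqrt mult.commute)
  then have "((\<lambda>s. if s \<in> {0..t} then s powr (- (1/2)) + 1 else 0) has_integral (2 * sqrt t + t)) UNIV"
    by (simp only: has_integral_restrict_UNIV)
  also have "(\<lambda>s. if s \<in> {0..t} then s powr (- (1/2)) + 1 else 0) = (\<lambda>s. indicator {0..t} s * (s powr (- (1/2)) + 1))"
    by (auto simp: indicator_def)
  finally show "((\<lambda>s. indicator {0..t} s * (s powr (- (1/2)) + 1)) has_integral (2 * sqrt t + t)) UNIV" .
qed auto

lemma inverse_sqrt_tendsto_0: "((\<lambda>t::real. 1 / sqrt t) \<longlongrightarrow> 0) at_top"
  by (intro tendsto_divide_0[OF tendsto_const] filterlim_at_top_imp_at_infinity sqrt_at_top)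

lemma affine_sqrt_over_self_tendsto:
  fixes r e k :: real
  shows "((\<lambda>t. (r * t + e + sqrt t * k) / t) \<longlongrightarrow> r) at_top"
proof (rule Lim_transform_eventually)
  have "((\<lambda>t::real. 1 / t) \<longlongrightarrow> 0) at_top"
    by (intro tendsto_divide_0[OF tendsto_const] filterlim_at_top_imp_at_infinity filterlim_ident)
  then have "((\<lambda>t. r + e * (1 / t) + (1 / sqrt t) * k) \<longlongrightarrow> r + e * 0 + 0 * k) at_top"
    by (intro tendsto_intros inverse_sqrt_tendsto_0)
  then show "((\<lambda>t. r + e * (1 / t) + (1 / sqrt t) * k) \<longlongrightarrow> r) at_top" by simp
  show "\<forall>\<^sub>F t in at_top. r + e * (1 / t) + (1 / sqrt t) * k = (r * t + e + sqrt t * k) / t"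
    using eventually_gt_at_top[of 0]
  proof eventually_elim
    case (elim t)
    then have "sqrt t * k / t = (1 / sqrt t) * k"
      using arg_cong[OF sqrt_divide_self_eq[of t], of "\<lambda>r. r * k"] by (simp add: inverse_eq_divide)
    with elim show ?case by (simp add: add_divide_distrib)
  qed
qed

section \<open>Hitting densities in the diffusive scale\<close>

lemma hit_density_nonneg: "0 \<le> s \<Longrightarrow> 0 \<le> hit_density s u \<mu>"
  by (simp add: hit_density_def)

lemma hit_density_measurable [measurable]:
  assumes [measurable]: "f \<in> borel_measurable M" "g \<in> borel_measurable M"
  shows "(\<lambda>w. hit_density (f w) (g w) \<mu>) \<in> borel_measurable M"
  unfolding hit_density_def by measurable

text \<open>Kendall's identity: the density in time of the hitting time is \<open>\<bar>u\<bar> / s\<close> times the density in space of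
the displacement at time \<open>s\<close>. It turns every estimate on hitting times into one on Gaussians.\<close>

lemma hit_density_eq_normal_density:
  assumes "s > 0"
  shows "hit_density s u \<mu> = \<bar>u\<bar> / s * normal_density 0 (sqrt s) (u + \<mu> * s)"
proof -
  have "sqrt (2 * pi * s ^ 3) = sqrt (2 * pi * s) * s"
    using assms by (simp add: power3_eq_cube real_sqrt_mult)
  then show ?thesis
    using assms by (simp add: hit_density_def normal_density_def field_simps)
qed

lemma hit_density_diffusive_scale:
  assumes "s > 0" "t > 0"
  shows "sqrt t * hit_density s (sqrt t * X + m * s) (- m)
       = \<bar>sqrt t * X + m * s\<bar> / s * normal_density 0 (sqrt (s / t)) X"
  using normal_density_scale[OF assms, of X, symmetric]
  by (simp add: hit_density_eq_normal_density[OF assms(1)] mult_ac)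

lemma scaled_drift_bound:
  fixes \<delta> s t X m :: real
  assumes "1 \<le> t" "0 < \<delta>" "\<delta> * t \<le> s" "s \<le> t" "0 < m"
  shows "\<bar>sqrt t * X + m * s\<bar> / s * normal_density 0 (sqrt (s / t)) X
       \<le> 1 / (\<delta> * sqrt \<delta>) * ((\<bar>X\<bar> + m) * std_normal_density X)"
proof -
  have s: "s > 0" using assms mult_pos_pos[of \<delta> t] by linarith
  have "sqrt t \<le> t"
    using assms(1) mult_left_mono[of 1 "sqrt t" "sqrt t"] by simp
  then have 1: "sqrt t * \<bar>X\<bar> \<le> t * \<bar>X\<bar>" by (rule mult_right_mono) simp
  have 2: "m * s \<le> m * t" using assms by simp
  have "\<bar>sqrt t * X + m * s\<bar> \<le> sqrt t * \<bar>X\<bar> + m * s"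
    using abs_triangle_ineq[of "sqrt t * X" "m * s"] assms s by (simp add: abs_mult)
  also have "\<dots> \<le> t * (\<bar>X\<bar> + m)" using 1 2 by (simp add: algebra_simps)
  finally have 3: "\<bar>sqrt t * X + m * s\<bar> \<le> t * (\<bar>X\<bar> + m)" .
  have "\<bar>sqrt t * X + m * s\<bar> / s \<le> t * (\<bar>X\<bar> + m) / (\<delta> * t)"
    by (rule frac_le) (use 3 assms in auto)
  also have "\<dots> = (\<bar>X\<bar> + m) / \<delta>" using assms by simp
  finally have 4: "\<bar>sqrt t * X + m * s\<bar> / s \<le> (\<bar>X\<bar> + m) / \<delta>" .
  have "\<delta> \<le> s / t" "s / t \<le> 1" using assms by (auto simp: field_simps)
  from normal_density_le_std[OF this assms(2)]
  have "normal_density 0 (sqrt (s / t)) X \<le> 1 / sqrt \<delta> * std_normal_density X" .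
  with 4 have "\<bar>sqrt t * X + m * s\<bar> / s * normal_density 0 (sqrt (s / t)) X
     \<le> (\<bar>X\<bar> + m) / \<delta> * (1 / sqrt \<delta> * std_normal_density X)"
    by (rule mult_mono) (use assms in auto)
  then show ?thesis by (simp add: field_simps)
qed

text \<open>The ratio of distance to time is the speed \<open>m\<close> up to a fluctuation of order \<open>1 / sqrt t\<close>, so in the
limit Kendall's prefactor is the constant \<open>m\<close>.\<close>

lemma scaled_drift_tendsto:
  fixes s :: "real \<Rightarrow> real" and \<theta> X m :: real
  assumes lim: "((\<lambda>t. s t / t) \<longlongrightarrow> \<theta>) at_top" and "0 < \<theta>" "0 < m"
  shows "((\<lambda>t. \<bar>sqrt t * X + m * s t\<bar> / s t * normal_density 0 (sqrt (s t / t)) X)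
           \<longlongrightarrow> m * normal_density 0 (sqrt \<theta>) X) at_top"
proof (rule tendsto_mult)
  have "((\<lambda>t. \<bar>1 / sqrt t * X + m * (s t / t)\<bar> / (s t / t)) \<longlongrightarrow> \<bar>0 * X + m * \<theta>\<bar> / \<theta>) at_top"
    by (intro tendsto_intros inverse_sqrt_tendsto_0 lim) (use assms in auto)
  moreover have "\<forall>\<^sub>F t in at_top. \<bar>1 / sqrt t * X + m * (s t / t)\<bar> / (s t / t) = \<bar>sqrt t * X + m * s t\<bar> / s t"
    using eventually_gt_at_top[of 0]
  proof eventually_elim
    case (elim t)
    have "1 / sqrt t * X + m * (s t / t) = (sqrt t * X + m * s t) / t"
      using elim arg_cong[OF sqrt_divide_self_eq[of t], of "\<lambda>r. r * X"]
      by (simp add: add_divide_distrib inverse_eq_divide)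
    then show ?case using elim by (simp add: abs_divide)
  qed
  ultimately have "((\<lambda>t. \<bar>sqrt t * X + m * s t\<bar> / s t) \<longlongrightarrow> \<bar>0 * X + m * \<theta>\<bar> / \<theta>) at_top"
    by (rule Lim_transform_eventually)
  then show "((\<lambda>t. \<bar>sqrt t * X + m * s t\<bar> / s t) \<longlongrightarrow> m) at_top"
    using assms(2,3) by simp
  show "((\<lambda>t. normal_density 0 (sqrt (s t / t)) X) \<longlongrightarrow> normal_density 0 (sqrt \<theta>) X) at_top"
    unfolding normal_density_def by (intro tendsto_intros lim) (use assms in auto)
qed

lemma drift_kernel_tendsto_0: "((\<lambda>t. drift_kernel t z \<mu>) \<longlongrightarrow> 0) at_top"
proof (rule tendsto_sandwich)
  show "\<forall>\<^sub>F t in at_top. 0 \<le> drift_kernel t z \<mu>"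
    using eventually_gt_at_top[of 0] by eventually_elim (simp add: drift_kernel_def)
  show "\<forall>\<^sub>F t in at_top. drift_kernel t z \<mu> \<le> 1 / sqrt (2 * pi * t)"
    using eventually_gt_at_top[of 0]
    by eventually_elim (simp add: drift_kernel_def divide_right_mono)
  have "filterlim (\<lambda>t::real. sqrt (2 * pi * t)) at_top at_top"
    by (intro filterlim_compose[OF sqrt_at_top] filterlim_tendsto_pos_mult_at_top[OF tendsto_const] filterlim_ident) auto
  then show "((\<lambda>t::real. 1 / sqrt (2 * pi * t)) \<longlongrightarrow> 0) at_top"
    by (intro tendsto_divide_0[OF tendsto_const] filterlim_at_top_imp_at_infinity)
qed auto

section \<open>The region of typical hitting times\<close>

text \<open>The number \<open>\<theta>\<close> is the fraction of the time \<open>t\<close> that the first hitting time takes on average, since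
\<open>(A / m) / (A / m + B / n) = A * n / D\<close>. The shifts \<open>p\<close> and \<open>q\<close> are absorbed into the new
coordinates, so that the exponent is \<open>- t / s * X\<^sup>2 / 2 - t / (t - s) * Y\<^sup>2 / 2\<close> without linear terms; they survive
only in the centre of \<open>s\<close>, where they are negligible against \<open>t\<close>. No Gaussian integral has to be evaluated,
because the limit integrand is a multiple of a product of probability densities.\<close>

lemma typical_region_tendsto:
  fixes A B m n p q :: real
  assumes A: "0 < A" and B: "0 < B" and m: "0 < m" and n: "0 < n"
  defines "D \<equiv> A * n + B * m"
  defines "\<theta> \<equiv> A * n / D"
  shows "((\<lambda>t. \<integral>\<^sup>+s. \<integral>\<^sup>+b. ennreal (indicator {0..} b * indicator {\<theta> / 2 * t..(1 + \<theta>) / 2 * t} s *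
            (hit_density s (A * b + p) (- m) * hit_density (t - s) (B * b + q) (- n))) \<partial>lborel \<partial>lborel)
          \<longlongrightarrow> ennreal (m * n / D)) at_top"
proof -
  have D: "0 < D" using assms(1-4) by (simp add: D_def add_pos_pos)
  have \<theta>: "0 < \<theta>" "\<theta> < 1"
    using assms(1-4) D by (simp_all add: \<theta>_def field_simps) (simp add: D_def)
  define e where "e = (B * p - A * q) / D"
  define \<delta> where "\<delta> = min \<theta> (1 - \<theta>) / 2"
  have \<delta>: "0 < \<delta>" "\<delta> \<le> \<theta> / 2" "\<delta> \<le> (1 - \<theta>) / 2" using \<theta> by (auto simp: \<delta>_def)
  \<comment> \<open>\<open>S\<close> and \<open>b\<close> solve \<open>A * b + p - m * S = sqrt t * X\<close> and
      \<open>B * b + q - n * (t - S) = sqrt t * Y\<close>.\<close>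
  define S where "S = (\<lambda>t X Y. \<theta> * t + e + sqrt t * (A * Y - B * X) / D)"
  define b where "b = (\<lambda>t X Y. (sqrt t * X + m * S t X Y - p) / A)"
  \<comment> \<open>The integrand in the new coordinates: \<open>W\<close> holds the region and the constant part of the
      Jacobian, and the factor \<open>t\<close> of the Jacobian is shared between \<open>P\<close> and \<open>Q\<close>, which are
      \<open>sqrt t\<close> times the two hitting densities. The limit is \<open>L\<close> and the dominating function is \<open>w\<close>.\<close>
  define W where "W = (\<lambda>t X Y. indicator {0..} (b t X Y) * indicator {\<theta> / 2 * t..(1 + \<theta>) / 2 * t} (S t X Y) / D :: real)"
  define P where "P = (\<lambda>t X Y. \<bar>sqrt t * X + m * S t X Y\<bar> / S t X Y * normal_density 0 (sqrt (S t X Y / t)) X)"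
  define Q where "Q = (\<lambda>t X Y. \<bar>sqrt t * Y + n * (t - S t X Y)\<bar> / (t - S t X Y) * normal_density 0 (sqrt ((t - S t X Y) / t)) Y)"
  define G where "G = (\<lambda>t z. W t (fst z) (snd z) * (P t (fst z) (snd z) * Q t (fst z) (snd z)))"
  define w where "w = (\<lambda>z::real\<times>real. (1 / D * (1 / (\<delta> * sqrt \<delta>) * ((\<bar>fst z\<bar> + m) * std_normal_density (fst z)))) *
                        (1 / (\<delta> * sqrt \<delta>) * ((\<bar>snd z\<bar> + n) * std_normal_density (snd z))))"
  define L where "L = (\<lambda>z::real\<times>real. (1 / D * (m * normal_density 0 (sqrt \<theta>) (fst z))) *
                       (n * normal_density 0 (sqrt (1 - \<theta>)) (snd z)))"
  have [measurable]: "(\<lambda>z. S t (fst z) (snd z)) \<in> borel_measurable (borel \<Otimes>\<^sub>M borel)" for t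
    unfolding S_def by measurable
  have [measurable]: "(\<lambda>z. b t (fst z) (snd z)) \<in> borel_measurable (borel \<Otimes>\<^sub>M borel)" for t
    unfolding b_def by measurable
  have [measurable]: "G t \<in> borel_measurable (borel \<Otimes>\<^sub>M borel)" for t
    unfolding G_def W_def P_def Q_def normal_density_def by measurable
  have G_meas: "G t \<in> borel_measurable (lborel \<Otimes>\<^sub>M lborel)" for t
    by measurable
  have w_int: "integrable (lborel \<Otimes>\<^sub>M lborel) w"
    unfolding w_def
    by (rule integral_tensor_product(1)) (intro integrable_mult_right integrable_abs_std_normal_density)+
  have L_int: "integrable (lborel \<Otimes>\<^sub>M lborel) L"
    and L_val: "(\<integral>z. L z \<partial>(lborel \<Otimes>\<^sub>M lborel)) = m * n / D"
    using \<theta> unfolding L_def by (subst integral_tensor_product | simp)+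
  have S_lim: "((\<lambda>t. S t X Y / t) \<longlongrightarrow> \<theta>) at_top" for X Y
    unfolding S_def using affine_sqrt_over_self_tendsto[of \<theta> e "(A * Y - B * X) / D"] by simp
  have S_lim': "((\<lambda>t. (t - S t X Y) / t) \<longlongrightarrow> 1 - \<theta>) at_top" for X Y
  proof (rule Lim_transform_eventually)
    show "((\<lambda>t. 1 - S t X Y / t) \<longlongrightarrow> 1 - \<theta>) at_top" by (intro tendsto_intros S_lim)
    show "\<forall>\<^sub>F t in at_top. 1 - S t X Y / t = (t - S t X Y) / t"
      using eventually_gt_at_top[of 0] by eventually_elim (simp add: diff_divide_distrib)
  qed
  have W_lim: "((\<lambda>t. W t X Y) \<longlongrightarrow> 1 / D) at_top" for X Y
  proof (rule tendsto_eventually)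
    have "filterlim (\<lambda>t. b t X Y) at_top at_top"
    proof (rule filterlim_at_top_mono)
      define k where "k = (X + m * (A * Y - B * X) / D) / A"
      define c where "c = (m * e - p) / A"
      have b_eq: "b t X Y = (m * \<theta> / A) * t + c + sqrt t * k" for t
        using A D by (simp add: b_def S_def k_def c_def field_simps)
      have lim: "((\<lambda>t. b t X Y / t) \<longlongrightarrow> m * \<theta> / A) at_top"
        unfolding b_eq by (rule affine_sqrt_over_self_tendsto)
      show "filterlim (\<lambda>t. b t X Y / t * t) at_top at_top"
        by (rule filterlim_tendsto_pos_mult_at_top[OF lim _ filterlim_ident]) (use A m \<theta> in simp)
      show "\<forall>\<^sub>F t in at_top. b t X Y / t * t \<le> b t X Y"
        using eventually_gt_at_top[of 0] by eventually_elim simp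
    qed
    then have "\<forall>\<^sub>F t in at_top. 0 \<le> b t X Y" by (simp add: filterlim_at_top)
    moreover have "\<forall>\<^sub>F t in at_top. \<theta> / 2 < S t X Y / t"
      by (rule order_tendstoD(1)[OF S_lim]) (use \<theta> in simp)
    moreover have "\<forall>\<^sub>F t in at_top. S t X Y / t < (1 + \<theta>) / 2"
      by (rule order_tendstoD(2)[OF S_lim]) (use \<theta> in simp)
    moreover note eventually_gt_at_top[of 0]
    ultimately show "\<forall>\<^sub>F t in at_top. W t X Y = 1 / D"
    proof eventually_elim
      case (elim t)
      then have "S t X Y \<in> {\<theta> / 2 * t..(1 + \<theta>) / 2 * t}"
        by (simp add: pos_less_divide_eq pos_divide_less_eq)
      with elim show ?case by (simp add: W_def)
    qed
  qed
  have lim: "((\<lambda>t. G t z) \<longlongrightarrow> L z) at_top" for z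
  proof -
    have P_lim: "((\<lambda>t. P t X Y) \<longlongrightarrow> m * normal_density 0 (sqrt \<theta>) X) at_top" for X Y
      unfolding P_def by (rule scaled_drift_tendsto[OF S_lim]) (use \<theta> m in auto)
    have Q_lim: "((\<lambda>t. Q t X Y) \<longlongrightarrow> n * normal_density 0 (sqrt (1 - \<theta>)) Y) at_top" for X Y
      unfolding Q_def by (rule scaled_drift_tendsto[OF S_lim']) (use \<theta> n in auto)
    show ?thesis
      using tendsto_mult[OF W_lim tendsto_mult[OF P_lim Q_lim]]
      by (simp only: G_def L_def mult.assoc)
  qed
  have G_nonneg: "0 \<le> G t z" and G_le: "G t z \<le> w z" if "1 \<le> t" for t z
  proof -
    obtain X Y where z: "z = (X, Y)" by (cases z)
    have "0 \<le> G t z \<and> G t z \<le> w z"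
    proof (cases "S t X Y \<in> {\<theta> / 2 * t..(1 + \<theta>) / 2 * t}")
      case True
      have d: "\<delta> * t \<le> \<theta> / 2 * t" "\<delta> * t \<le> (1 - \<theta>) / 2 * t"
        using \<delta> that by (auto intro!: mult_right_mono)
      have "\<theta> * t \<le> t" "0 \<le> \<theta> * t" using \<theta> that by auto
      with True d have s: "\<delta> * t \<le> S t X Y" "S t X Y \<le> t" "\<delta> * t \<le> t - S t X Y" "t - S t X Y \<le> t"
        by (auto simp: algebra_simps)
      have "0 < \<delta> * t" using \<delta> that by simp
      with s have s0: "0 < S t X Y" "0 < t - S t X Y" by linarith+
      have P: "0 \<le> P t X Y" "P t X Y \<le> 1 / (\<delta> * sqrt \<delta>) * ((\<bar>X\<bar> + m) * std_normal_density X)"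
        unfolding P_def using scaled_drift_bound[OF that \<delta>(1) s(1,2) m] s0 by auto
      have Q: "0 \<le> Q t X Y" "Q t X Y \<le> 1 / (\<delta> * sqrt \<delta>) * ((\<bar>Y\<bar> + n) * std_normal_density Y)"
        unfolding Q_def using scaled_drift_bound[OF that \<delta>(1) s(3,4) n] s0 by auto
      have W: "0 \<le> W t X Y" "W t X Y \<le> 1 / D"
        using D by (auto simp: W_def indicator_def)
      have "W t X Y * (P t X Y * Q t X Y) \<le> 1 / D * (1 / (\<delta> * sqrt \<delta>) * ((\<bar>X\<bar> + m) * std_normal_density X) *
              (1 / (\<delta> * sqrt \<delta>) * ((\<bar>Y\<bar> + n) * std_normal_density Y)))"
        using D \<delta> m by (intro mult_mono W P Q mult_nonneg_nonneg) auto
      then show ?thesis using W P Q by (simp add: G_def w_def z mult.assoc)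
    next
      case False
      then show ?thesis using D \<delta> m n by (simp add: G_def w_def W_def z)
    qed
    then show "0 \<le> G t z" "G t z \<le> w z" by auto
  qed
  have G_lim: "((\<lambda>t. \<integral>z. G t z \<partial>(lborel \<Otimes>\<^sub>M lborel)) \<longlongrightarrow> m * n / D) at_top"
    unfolding L_val[symmetric]
  proof (rule integral_dominated_convergence_at_top[OF _ _ w_int])
    show "\<forall>\<^sub>F t in at_top. AE z in lborel \<Otimes>\<^sub>M lborel. norm (G t z) \<le> w z"
      using eventually_ge_at_top[of 1] by eventually_elim (use G_nonneg G_le in auto)
    show "L \<in> borel_measurable (lborel \<Otimes>\<^sub>M lborel)" using L_int by simp
  qed (use lim G_meas in auto)
  have "\<forall>\<^sub>F t in at_top. (\<integral>\<^sup>+s. \<integral>\<^sup>+b. ennreal (indicator {0..} b * indicator {\<theta> / 2 * t..(1 + \<theta>) / 2 * t} s *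
            (hit_density s (A * b + p) (- m) * hit_density (t - s) (B * b + q) (- n))) \<partial>lborel \<partial>lborel)
      = ennreal (\<integral>z. G t z \<partial>(lborel \<Otimes>\<^sub>M lborel))"
    using eventually_ge_at_top[of 1]
  proof eventually_elim
    case (elim t)
    define f where "f = (\<lambda>(b, s). ennreal (indicator {0..} b * indicator {\<theta> / 2 * t..(1 + \<theta>) / 2 * t} s *
            (hit_density s (A * b + p) (- m) * hit_density (t - s) (B * b + q) (- n))))"
    have f' [measurable]: "f \<in> borel_measurable (borel \<Otimes>\<^sub>M borel)"
      unfolding f_def by measurable
    then have f: "f \<in> borel_measurable borel" by (simp add: borel_prod)
    have fS: "(\<lambda>z. f (b t (fst z) (snd z), S t (fst z) (snd z))) \<in> borel_measurable (lborel \<Otimes>\<^sub>M lborel)"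
      by measurable
    \<comment> \<open>The first equation for \<open>S\<close> and \<open>b\<close> is the definition of \<open>b\<close>; the second one follows by
        eliminating \<open>b\<close> from the definition of \<open>S\<close>.\<close>
    have fG: "ennreal (t / D) * f (b t X Y, S t X Y) = ennreal (G t (X, Y))" for X Y
    proof (cases "S t X Y \<in> {\<theta> / 2 * t..(1 + \<theta>) / 2 * t}")
      case True
      have "0 < \<theta> / 2 * t" using \<theta> elim by simp
      moreover have "(1 + \<theta>) / 2 * t < t" using \<theta> elim by simp
      ultimately have s0: "0 < S t X Y" "0 < t - S t X Y" using True by auto
      have u: "A * b t X Y + p = sqrt t * X + m * S t X Y" using A by (simp add: b_def)
      have "A * (B * b t X Y + q) = B * (sqrt t * X + m * S t X Y - p) + A * q"
        using A by (simp add: b_def field_simps)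
      also have "\<dots> = A * (sqrt t * Y + n * (t - S t X Y))"
      proof -
        have "D * S t X Y = A * n * t + (B * p - A * q) + sqrt t * (A * Y - B * X)"
          using D by (simp add: S_def e_def \<theta>_def field_simps)
        then show ?thesis by (simp add: D_def algebra_simps)
      qed
      finally have v: "B * b t X Y + q = sqrt t * Y + n * (t - S t X Y)" using A by simp
      have t: "0 < t" "t = sqrt t * sqrt t" using elim by auto
      have "t * (hit_density (S t X Y) (A * b t X Y + p) (- m) * hit_density (t - S t X Y) (B * b t X Y + q) (- n))
         = (sqrt t * hit_density (S t X Y) (A * b t X Y + p) (- m)) * (sqrt t * hit_density (t - S t X Y) (B * b t X Y + q) (- n))"
        by (subst t(2)) (simp only: mult_ac)
      also have "\<dots> = P t X Y * Q t X Y"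
        unfolding u v hit_density_diffusive_scale[OF s0(1) t(1)] hit_density_diffusive_scale[OF s0(2) t(1)]
          P_def Q_def ..
      finally have hPQ: "t * (hit_density (S t X Y) (A * b t X Y + p) (- m) * hit_density (t - S t X Y) (B * b t X Y + q) (- n))
         = P t X Y * Q t X Y" .
      show ?thesis
        using D t by (simp add: f_def G_def W_def ennreal_mult'[symmetric] hPQ[symmetric])
          (simp add: mult_ac)
    next
      case False
      then show ?thesis by (simp add: f_def G_def W_def)
    qed
    have "(\<integral>\<^sup>+s. \<integral>\<^sup>+b. f (b, s) \<partial>lborel \<partial>lborel)
      = ennreal (\<bar>sqrt t / A\<bar> * \<bar>sqrt t * A / D\<bar>) *
         (\<integral>\<^sup>+X. \<integral>\<^sup>+Y. f (- p / A + m / A * (\<theta> * t + e + (- (sqrt t * B / D)) * X + (sqrt t * A / D) * Y) + sqrt t / A * X,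
            \<theta> * t + e + (- (sqrt t * B / D)) * X + (sqrt t * A / D) * Y) \<partial>lborel \<partial>lborel)"
      by (rule nn_integral_plane_shear[OF f]) (use A D elim in auto)
    also have "\<bar>sqrt t / A\<bar> * \<bar>sqrt t * A / D\<bar> = t / D"
      using A D elim by simp
    also have "(\<lambda>X Y. f (- p / A + m / A * (\<theta> * t + e + (- (sqrt t * B / D)) * X + (sqrt t * A / D) * Y) + sqrt t / A * X,
            \<theta> * t + e + (- (sqrt t * B / D)) * X + (sqrt t * A / D) * Y)) = (\<lambda>X Y. f (b t X Y, S t X Y))"
    proof (intro ext)
      fix X Y
      have 1: "\<theta> * t + e + (- (sqrt t * B / D)) * X + (sqrt t * A / D) * Y = S t X Y"
        using D by (simp add: S_def field_simps)
      have 2: "- p / A + m / A * S t X Y + sqrt t / A * X = b t X Y"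
        using A by (simp add: b_def field_simps)
      show "f (- p / A + m / A * (\<theta> * t + e + (- (sqrt t * B / D)) * X + (sqrt t * A / D) * Y) + sqrt t / A * X,
            \<theta> * t + e + (- (sqrt t * B / D)) * X + (sqrt t * A / D) * Y) = f (b t X Y, S t X Y)"
        unfolding 1 2 ..
    qed
    also have "(\<integral>\<^sup>+X. \<integral>\<^sup>+Y. f (b t X Y, S t X Y) \<partial>lborel \<partial>lborel)
      = (\<integral>\<^sup>+z. f (b t (fst z) (snd z), S t (fst z) (snd z)) \<partial>(lborel \<Otimes>\<^sub>M lborel))"
      using lborel.nn_integral_fst[OF fS] by simp
    also have "ennreal (t / D) * \<dots> = (\<integral>\<^sup>+z. ennreal (t / D) * f (b t (fst z) (snd z), S t (fst z) (snd z)) \<partial>(lborel \<Otimes>\<^sub>M lborel))"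
      by (rule nn_integral_cmult[OF fS, symmetric])
    also have "\<dots> = (\<integral>\<^sup>+z. ennreal (G t z) \<partial>(lborel \<Otimes>\<^sub>M lborel))"
      unfolding fG by simp
    also have "\<dots> = ennreal (\<integral>z. G t z \<partial>(lborel \<Otimes>\<^sub>M lborel))"
    proof (rule nn_integral_eq_integral)
      show "integrable (lborel \<Otimes>\<^sub>M lborel) (G t)"
      proof (rule Bochner_Integration.integrable_bound[OF w_int G_meas AE_I2])
        show "norm (G t z) \<le> norm (w z)" for z
          using G_nonneg[OF elim, of z] G_le[OF elim, of z] by simp
      qed
    qed (use G_nonneg[OF elim] in auto)
    finally show ?case by (simp add: f_def)
  qed
  then show ?thesis
    by (subst tendsto_cong) (auto intro: tendsto_ennrealI G_lim)
qed

section \<open>The region of atypical hitting times\<close>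

text \<open>With \<open>X = sqrt s * z\<close> the deviation of the first hitting time and \<open>Y\<close> that of the second, eliminating
\<open>b\<close> expresses \<open>B * X - A * Y\<close> as \<open>A * n * t - (A * n + B * m) * s\<close> up to a constant. If \<open>s\<close> is at most
half its typical value this is of order \<open>t\<close>, and Cauchy-Schwarz forces \<open>X\<^sup>2 + Y\<^sup>2\<close> to be of order
\<open>t\<^sup>2\<close>. The term \<open>z\<^sup>2 / 4\<close> is kept on the left because integrability in \<open>z\<close> is still needed after the
factor that decays in \<open>t\<close> has been split off.\<close>

lemma atypical_exponent_bound:
  fixes A B m n p q s t z :: real
  assumes A: "0 < A" and n: "0 < n"
    and s: "0 < s" "s < t"
    and half: "(A * n + B * m) * s \<le> A * n * t / 2"
    and t: "4 * \<bar>B * p - A * q\<bar> \<le> A * n * t"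
  defines "v \<equiv> B * ((sqrt s * z + m * s - p) / A) + q"
  shows "(A * n)\<^sup>2 / (64 * (A\<^sup>2 + B\<^sup>2)) * t + z\<^sup>2 / 4 \<le> z\<^sup>2 / 2 + (v - n * (t - s))\<^sup>2 / (2 * (t - s))"
proof -
  define X where "X = sqrt s * z"
  define Y where "Y = v - n * (t - s)"
  define R where "R = z\<^sup>2 + Y\<^sup>2 / (t - s)"
  have "B * X - A * Y = B * p - A * q + A * n * t - (A * n + B * m) * s"
    using A by (simp add: X_def Y_def v_def field_simps)
  moreover define e N C where "e = B * p - A * q" and "N = A * n * t" and "C = (A * n + B * m) * s"
  ultimately have "B * X - A * Y = e + N - C" "C \<le> N / 2" "4 * \<bar>e\<bar> \<le> N"
    using half t by simp_all
  then have "N / 4 \<le> B * X - A * Y" by linarith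
  then have "A * n * t / 4 \<le> B * X - A * Y" by (simp add: N_def)
  moreover have "0 \<le> A * n * t / 4" using A n s by simp
  ultimately have "(A * n * t / 4)\<^sup>2 \<le> (B * X - A * Y)\<^sup>2" by (intro power_mono) auto
  also have "\<dots> \<le> (A\<^sup>2 + B\<^sup>2) * (X\<^sup>2 + Y\<^sup>2)"
    using sum_squares_ge_zero[of 0 "A * X + B * Y"] by (simp add: power2_eq_square algebra_simps)
  \<comment> \<open>Neither hitting time exceeds \<open>t\<close>.\<close>
  also have "X\<^sup>2 + Y\<^sup>2 \<le> t * R"
  proof -
    have "X\<^sup>2 = s * z\<^sup>2" using s by (simp add: X_def power_mult_distrib)
    moreover have "s * z\<^sup>2 \<le> t * z\<^sup>2" using s by (intro mult_right_mono) auto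
    moreover have "(t - s) * (Y\<^sup>2 / (t - s)) \<le> t * (Y\<^sup>2 / (t - s))" using s by (intro mult_right_mono) auto
    ultimately show ?thesis using s by (simp add: R_def distrib_left)
  qed
  finally have "(A * n * t / 4)\<^sup>2 \<le> (A\<^sup>2 + B\<^sup>2) * (t * R)"
    using A by (simp add: mult_left_mono)
  then have "t * ((A * n)\<^sup>2 * t) \<le> t * (16 * (A\<^sup>2 + B\<^sup>2) * R)"
    by (simp add: power2_eq_square algebra_simps)
  then have "(A * n)\<^sup>2 * t \<le> 16 * (A\<^sup>2 + B\<^sup>2) * (z\<^sup>2 + Y\<^sup>2 / (t - s))"
    unfolding R_def[symmetric] by (rule mult_left_le_imp_le) (use s in simp)
  moreover have "0 < A\<^sup>2 + B\<^sup>2" using A by (simp add: add_pos_nonneg)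
  ultimately have "(A * n)\<^sup>2 * t / (16 * (A\<^sup>2 + B\<^sup>2)) \<le> z\<^sup>2 + Y\<^sup>2 / (t - s)"
    by (simp add: pos_divide_le_eq mult.commute)
  moreover define V W where "V = (A * n)\<^sup>2 * t / (16 * (A\<^sup>2 + B\<^sup>2))" and "W = Y\<^sup>2 / (t - s)"
  ultimately have "V \<le> z\<^sup>2 + W" by (simp only:)
  moreover have "0 \<le> W" using s by (simp add: W_def)
  ultimately have "V / 4 + z\<^sup>2 / 4 \<le> z\<^sup>2 / 2 + W / 2" by linarith
  moreover have "(A * n)\<^sup>2 / (64 * (A\<^sup>2 + B\<^sup>2)) * t = V / 4" by (simp add: V_def)
  moreover have "Y\<^sup>2 / (2 * (t - s)) = W / 2" by (simp add: W_def)
  ultimately show ?thesis unfolding Y_def by (simp only:)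
qed

text \<open>The substitution \<open>u = m * s + sqrt s * z\<close> removes the singularity of the hitting density at \<open>s = 0\<close> up
to the integrable factor \<open>s powr (- (1/2))\<close>. The other hitting time is at least \<open>t / 2\<close> and its
density is not singular there.\<close>

lemma atypical_integrand_bound:
  fixes A B m n p q s t z :: real
  assumes A: "0 < A" and B: "0 < B" and m: "0 < m" and n: "0 < n"
    and s: "0 < s" "s \<le> t / 2" and t1: "1 \<le> t"
    and half: "(A * n + B * m) * s \<le> A * n * t / 2"
    and t: "4 * \<bar>B * p - A * q\<bar> \<le> A * n * t"
  defines "v \<equiv> B * ((sqrt s * z + m * s - p) / A) + q"
    and "\<kappa> \<equiv> (A * n)\<^sup>2 / (64 * (A\<^sup>2 + B\<^sup>2))"
    and "K \<equiv> B / A * (1 + m + \<bar>p\<bar>) + \<bar>q\<bar>"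
  shows "sqrt s * hit_density s (sqrt s * z + m * s) (- m) * hit_density (t - s) v (- n)
    \<le> 4 * (1 + m) * K * t * exp (- \<kappa> * t) * (s powr (- (1/2)) + 1) * ((1 + \<bar>z\<bar>)\<^sup>2 * normal_density 0 (sqrt 2) z)"
proof -
  have st: "s < t" "1 / 2 \<le> t - s" using s t1 by auto
  define Y where "Y = v - n * (t - s)"
  have ss: "1 / sqrt s = s powr (- (1/2))"
    using s by (simp add: powr_minus powr_half_sqrt inverse_eq_divide)
  have "sqrt s * hit_density s (sqrt s * z + m * s) (- m) = \<bar>sqrt s * z + m * s\<bar> / s * std_normal_density z"
    using hit_density_diffusive_scale[OF s(1) s(1), of z m] s by simp
  moreover have "\<bar>sqrt s * z + m * s\<bar> / s \<le> (1 + m) * ((s powr (- (1/2)) + 1) * (1 + \<bar>z\<bar>))"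
  proof -
    have "\<bar>sqrt s * z + m * s\<bar> / s \<le> (sqrt s * \<bar>z\<bar> + m * s) / s"
      using abs_triangle_ineq[of "sqrt s * z" "m * s"] s m by (intro divide_right_mono) (auto simp: abs_mult)
    also have "\<dots> = s powr (- (1/2)) * \<bar>z\<bar> + m"
      using s arg_cong[OF sqrt_divide_self_eq[of s], of "\<lambda>r. r * \<bar>z\<bar>"] ss
      by (simp add: add_divide_distrib inverse_eq_divide)
    also have "\<dots> \<le> (1 + m) * ((s powr (- (1/2)) + 1) * (1 + \<bar>z\<bar>))"
    proof -
      have "0 \<le> m * (s powr (- (1/2)) * \<bar>z\<bar>)" "0 \<le> m * (s powr (- (1/2)))" "0 \<le> m * \<bar>z\<bar>"
        "0 \<le> s powr (- (1/2))" using m by auto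
      then show ?thesis by (simp add: algebra_simps)
    qed
    finally show ?thesis .
  qed
  ultimately have 1: "sqrt s * hit_density s (sqrt s * z + m * s) (- m)
      \<le> (1 + m) * ((s powr (- (1/2)) + 1) * (1 + \<bar>z\<bar>)) * std_normal_density z"
    by (simp only:) (rule mult_right_mono, simp_all)
  have K: "0 \<le> K" using A B m by (simp add: K_def)
  have v_le: "\<bar>v\<bar> \<le> K * (t * (1 + \<bar>z\<bar>))"
  proof -
    have "sqrt s \<le> sqrt t" using st by simp
    also have "\<dots> \<le> t" using t1 mult_left_mono[of 1 "sqrt t" "sqrt t"] by simp
    finally have a: "sqrt s * \<bar>z\<bar> \<le> t * \<bar>z\<bar>" by (rule mult_right_mono) simp
    have b: "m * s \<le> m * t" using m st by simp
    have c: "\<bar>p\<bar> * 1 \<le> \<bar>p\<bar> * t" "\<bar>q\<bar> * 1 \<le> \<bar>q\<bar> * t" using t1 by (intro mult_left_mono; simp)+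
    have nn: "0 \<le> m * t * \<bar>z\<bar>" "0 \<le> \<bar>p\<bar> * t * \<bar>z\<bar>" "0 \<le> \<bar>q\<bar> * t * \<bar>z\<bar>" using m t1 by auto
    have "\<bar>sqrt s * z + m * s - p\<bar> \<le> sqrt s * \<bar>z\<bar> + m * s + \<bar>p\<bar>"
    proof -
      have "\<bar>sqrt s * z\<bar> = sqrt s * \<bar>z\<bar>" "\<bar>m * s\<bar> = m * s" using m s by (auto simp: abs_mult)
      then show ?thesis by linarith
    qed
    also have "\<dots> \<le> (1 + m + \<bar>p\<bar>) * (t * (1 + \<bar>z\<bar>))"
    proof -
      have "(1 + m + \<bar>p\<bar>) * (t * (1 + \<bar>z\<bar>)) = t + m * t + \<bar>p\<bar> * t + t * \<bar>z\<bar> + m * t * \<bar>z\<bar> + \<bar>p\<bar> * t * \<bar>z\<bar>"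
        by (simp add: algebra_simps)
      then show ?thesis using a b c nn t1 by linarith
    qed
    finally have d: "\<bar>sqrt s * z + m * s - p\<bar> \<le> (1 + m + \<bar>p\<bar>) * (t * (1 + \<bar>z\<bar>))" .
    have e: "\<bar>q\<bar> \<le> \<bar>q\<bar> * (t * (1 + \<bar>z\<bar>))"
    proof -
      have "\<bar>q\<bar> * (t * (1 + \<bar>z\<bar>)) = \<bar>q\<bar> * t + \<bar>q\<bar> * t * \<bar>z\<bar>" by (simp add: algebra_simps)
      then show ?thesis using c nn by linarith
    qed
    have "\<bar>v\<bar> \<le> \<bar>B / A * (sqrt s * z + m * s - p)\<bar> + \<bar>q\<bar>"
      unfolding v_def using abs_triangle_ineq[of "B / A * (sqrt s * z + m * s - p)" q] by simp
    also have "\<bar>B / A * (sqrt s * z + m * s - p)\<bar> = B / A * \<bar>sqrt s * z + m * s - p\<bar>"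
      using A B by (simp add: abs_mult)
    also have "\<dots> \<le> B / A * ((1 + m + \<bar>p\<bar>) * (t * (1 + \<bar>z\<bar>)))"
      using d A B by (intro mult_left_mono) auto
    finally show ?thesis using e by (simp add: K_def distrib_right mult.assoc)
  qed
  have 2: "hit_density (t - s) v (- n) \<le> 2 * (K * (t * (1 + \<bar>z\<bar>))) * exp (- Y\<^sup>2 / (2 * (t - s)))"
  proof -
    have "pi * 1 \<le> pi * (2 * (t - s))" using st by (intro mult_left_mono) auto
    then have "1 \<le> pi * (2 * (t - s))" using pi_gt3 by linarith
    then have "1 \<le> 2 * pi * (t - s)" by (simp only: mult_ac)
    then have sq: "1 / sqrt (2 * pi * (t - s)) \<le> 1" by simp
    have "\<bar>v\<bar> / (t - s) \<le> K * (t * (1 + \<bar>z\<bar>)) / (1 / 2)"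
      by (rule frac_le) (use v_le K st t1 in auto)
    then have a: "\<bar>v\<bar> / (t - s) \<le> 2 * (K * (t * (1 + \<bar>z\<bar>)))" by simp
    have "normal_density 0 (sqrt (t - s)) Y \<le> 1 * exp (- Y\<^sup>2 / (2 * (t - s)))"
      unfolding normal_density_def using st sq by (intro mult_mono) auto
    with a have "\<bar>v\<bar> / (t - s) * normal_density 0 (sqrt (t - s)) Y
        \<le> 2 * (K * (t * (1 + \<bar>z\<bar>))) * (1 * exp (- Y\<^sup>2 / (2 * (t - s))))"
      by (rule mult_mono) (use K t1 in auto)
    moreover have "hit_density (t - s) v (- n) = \<bar>v\<bar> / (t - s) * normal_density 0 (sqrt (t - s)) Y"
      using st by (simp add: hit_density_eq_normal_density Y_def)
    ultimately show ?thesis by simp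
  qed
  \<comment> \<open>The variance \<open>2\<close> on the right is the price for the decay in \<open>t\<close>: only half of the exponent
      \<open>z\<^sup>2 / 2\<close> remains.\<close>
  have 3: "std_normal_density z * exp (- Y\<^sup>2 / (2 * (t - s))) \<le> 2 * (exp (- \<kappa> * t) * normal_density 0 (sqrt 2) z)"
  proof -
    have "\<kappa> * t + z\<^sup>2 / 4 \<le> z\<^sup>2 / 2 + Y\<^sup>2 / (2 * (t - s))"
      using atypical_exponent_bound[OF A n s(1) st(1) half t, of z] by (simp add: \<kappa>_def Y_def v_def)
    then have "exp (- z\<^sup>2 / 2 + - Y\<^sup>2 / (2 * (t - s))) \<le> exp (- \<kappa> * t + - z\<^sup>2 / 4)" by simp
    then have "exp (- z\<^sup>2 / 2) * exp (- Y\<^sup>2 / (2 * (t - s))) \<le> exp (- \<kappa> * t) * exp (- z\<^sup>2 / 4)"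
      by (simp only: exp_add)
    then have "1 / sqrt (2 * pi) * (exp (- z\<^sup>2 / 2) * exp (- Y\<^sup>2 / (2 * (t - s)))) \<le> 2 / sqrt (4 * pi) * (exp (- \<kappa> * t) * exp (- z\<^sup>2 / 4))"
    proof (rule mult_mono[rotated])
      have "2 / sqrt (4 * pi) = 1 / sqrt pi" by (simp add: real_sqrt_mult)
      moreover have "1 / sqrt (2 * pi) \<le> 1 / sqrt pi" by (intro divide_left_mono) auto
      ultimately show "1 / sqrt (2 * pi) \<le> 2 / sqrt (4 * pi)" by simp
    qed auto
    then show ?thesis by (simp add: normal_density_def mult_ac)
  qed
  have "sqrt s * hit_density s (sqrt s * z + m * s) (- m) * hit_density (t - s) v (- n)
    \<le> ((1 + m) * ((s powr (- (1/2)) + 1) * (1 + \<bar>z\<bar>)) * std_normal_density z) *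
       (2 * (K * (t * (1 + \<bar>z\<bar>))) * exp (- Y\<^sup>2 / (2 * (t - s))))"
    by (rule mult_mono[OF 1 2]) (use m st in \<open>auto intro!: mult_nonneg_nonneg hit_density_nonneg\<close>)
  also have "\<dots> = ((1 + m) * ((s powr (- (1/2)) + 1) * (1 + \<bar>z\<bar>)) * (2 * (K * (t * (1 + \<bar>z\<bar>))))) *
       (std_normal_density z * exp (- Y\<^sup>2 / (2 * (t - s))))"
    by (simp only: mult_ac)
  also have "\<dots> \<le> ((1 + m) * ((s powr (- (1/2)) + 1) * (1 + \<bar>z\<bar>)) * (2 * (K * (t * (1 + \<bar>z\<bar>))))) *
       (2 * (exp (- \<kappa> * t) * normal_density 0 (sqrt 2) z))"
    by (rule mult_left_mono[OF 3]) (use m K t1 in auto)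
  also have "\<dots> = 4 * (1 + m) * K * t * exp (- \<kappa> * t) * (s powr (- (1/2)) + 1) * ((1 + \<bar>z\<bar>)\<^sup>2 * normal_density 0 (sqrt 2) z)"
    by (simp add: power2_eq_square)
  finally show ?thesis .
qed

text \<open>The bound on the integrand integrates to \<open>exp (- \<kappa> * t)\<close> times a polynomial in \<open>sqrt t\<close>. Only short
first hitting times need to be considered: short second ones are the same case after exchanging the
two motions.\<close>

lemma atypical_region_tendsto_0:
  fixes A B m n p q :: real
  assumes A: "0 < A" and B: "0 < B" and m: "0 < m" and n: "0 < n"
  defines "\<theta> \<equiv> A * n / (A * n + B * m)"
  shows "((\<lambda>t. \<integral>\<^sup>+s. \<integral>\<^sup>+b. ennreal (indicator {0..} b * indicator {0..\<theta> / 2 * t} s *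
            (hit_density s (A * b + p) (- m) * hit_density (t - s) (B * b + q) (- n))) \<partial>lborel \<partial>lborel)
          \<longlongrightarrow> 0) at_top"
proof -
  define D where "D = A * n + B * m"
  have D: "0 < D" using assms(1-4) by (simp add: D_def add_pos_pos)
  have \<theta>: "0 < \<theta>" "\<theta> < 1"
    using assms(1-4) D by (simp_all add: \<theta>_def field_simps add_pos_pos)
  define \<kappa> where "\<kappa> = (A * n)\<^sup>2 / (64 * (A\<^sup>2 + B\<^sup>2))"
  have \<kappa>: "0 < \<kappa>" using A B n by (simp add: \<kappa>_def add_pos_pos)
  define K where "K = B / A * (1 + m + \<bar>p\<bar>) + \<bar>q\<bar>"
  have K: "0 \<le> K" using A B m by (simp add: K_def)
  define C where "C = 4 * (1 + m) * K / A"
  have C: "0 \<le> C" using K A m by (simp add: C_def)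
  define J where "J = (\<integral>z. (1 + \<bar>z\<bar>)\<^sup>2 * normal_density 0 (sqrt 2) z \<partial>lborel)"
  have J: "0 \<le> J" by (auto simp: J_def intro!: Bochner_Integration.integral_nonneg)
  have J_nn: "(\<integral>\<^sup>+z. ennreal ((1 + \<bar>z\<bar>)\<^sup>2 * normal_density 0 (sqrt 2) z) \<partial>lborel) = ennreal J"
    unfolding J_def by (rule nn_integral_eq_integral[OF integrable_gaussian_tail_weight]) simp
  have bound: "\<forall>\<^sub>F t in at_top. (\<integral>\<^sup>+s. \<integral>\<^sup>+b. ennreal (indicator {0..} b * indicator {0..\<theta> / 2 * t} s *
            (hit_density s (A * b + p) (- m) * hit_density (t - s) (B * b + q) (- n))) \<partial>lborel \<partial>lborel)
      \<le> ennreal (C * J * (t * exp (- \<kappa> * t) * (2 * sqrt t + t)))"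
    using eventually_ge_at_top[of 1] eventually_ge_at_top[of "4 * \<bar>B * p - A * q\<bar> / (A * n)"]
  proof eventually_elim
    case (elim t)
    define E where "E = C * (t * exp (- \<kappa> * t))"
    have E: "0 \<le> E" using C elim by (simp add: E_def)
    have t: "4 * \<bar>B * p - A * q\<bar> \<le> A * n * t" using elim A n by (simp add: pos_divide_le_eq mult.commute)
    have inner: "(\<integral>\<^sup>+b. ennreal (indicator {0..} b * indicator {0..\<theta> / 2 * t} s *
            (hit_density s (A * b + p) (- m) * hit_density (t - s) (B * b + q) (- n))) \<partial>lborel)
        \<le> ennreal (E * J) * ennreal (indicator {0..t} s * (s powr (- (1/2)) + 1))" for s
    proof (cases "0 < s \<and> s \<le> \<theta> / 2 * t")
      case True
      have "\<theta> * t \<le> t" using \<theta> elim by simp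
      with True have s: "0 < s" "s \<le> t / 2" by auto
      have half: "(A * n + B * m) * s \<le> A * n * t / 2"
        using True D by (simp add: \<theta>_def D_def[symmetric] pos_le_divide_eq mult_ac)
      have "(\<integral>\<^sup>+b. ennreal (indicator {0..} b * indicator {0..\<theta> / 2 * t} s *
            (hit_density s (A * b + p) (- m) * hit_density (t - s) (B * b + q) (- n))) \<partial>lborel)
          \<le> (\<integral>\<^sup>+b. ennreal (hit_density s (A * b + p) (- m) * hit_density (t - s) (B * b + q) (- n)) \<partial>lborel)"
        by (intro nn_integral_mono ennreal_leI)
          (use s elim in \<open>auto simp: indicator_def intro!: mult_nonneg_nonneg hit_density_nonneg\<close>)
      also have "\<dots> = ennreal \<bar>sqrt s / A\<bar> * (\<integral>\<^sup>+z. ennreal (hit_density s (A * ((m * s - p) / A + sqrt s / A * z) + p) (- m) *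
              hit_density (t - s) (B * ((m * s - p) / A + sqrt s / A * z) + q) (- n)) \<partial>lborel)"
        by (rule nn_integral_real_affine) (use s A in auto)
      also have "\<dots> = (\<integral>\<^sup>+z. ennreal \<bar>sqrt s / A\<bar> * ennreal (hit_density s (A * ((m * s - p) / A + sqrt s / A * z) + p) (- m) *
              hit_density (t - s) (B * ((m * s - p) / A + sqrt s / A * z) + q) (- n)) \<partial>lborel)"
        by (rule nn_integral_cmult[symmetric]) measurable
      also have "\<dots> \<le> (\<integral>\<^sup>+z. ennreal (E * (s powr (- (1/2)) + 1)) * ennreal ((1 + \<bar>z\<bar>)\<^sup>2 * normal_density 0 (sqrt 2) z) \<partial>lborel)"
      proof (rule nn_integral_mono)
        fix z :: real
        have eq: "(m * s - p) / A + sqrt s / A * z = (sqrt s * z + m * s - p) / A"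
          using A by (simp add: field_simps)
        have eq2: "A * ((sqrt s * z + m * s - p) / A) + p = sqrt s * z + m * s" using A by simp
        have weight_nonneg: "0 \<le> E * (s powr (- (1/2)) + 1)" using E by simp
        have "sqrt s * hit_density s (sqrt s * z + m * s) (- m) * hit_density (t - s) (B * ((sqrt s * z + m * s - p) / A) + q) (- n)
            \<le> 4 * (1 + m) * K * t * exp (- \<kappa> * t) * (s powr (- (1/2)) + 1) * ((1 + \<bar>z\<bar>)\<^sup>2 * normal_density 0 (sqrt 2) z)"
          unfolding K_def \<kappa>_def by (rule atypical_integrand_bound[OF A B m n s elim(1) half t])
        then have "(sqrt s * hit_density s (sqrt s * z + m * s) (- m) * hit_density (t - s) (B * ((sqrt s * z + m * s - p) / A) + q) (- n)) / A
            \<le> (4 * (1 + m) * K * t * exp (- \<kappa> * t) * (s powr (- (1/2)) + 1) * ((1 + \<bar>z\<bar>)\<^sup>2 * normal_density 0 (sqrt 2) z)) / A"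
          by (rule divide_right_mono) (use A in simp)
        then have le: "\<bar>sqrt s / A\<bar> * (hit_density s (sqrt s * z + m * s) (- m) * hit_density (t - s) (B * ((sqrt s * z + m * s - p) / A) + q) (- n))
           \<le> E * (s powr (- (1/2)) + 1) * ((1 + \<bar>z\<bar>)\<^sup>2 * normal_density 0 (sqrt 2) z)"
          using A s by (simp add: E_def C_def mult_ac)
        show "ennreal \<bar>sqrt s / A\<bar> * ennreal (hit_density s (A * ((m * s - p) / A + sqrt s / A * z) + p) (- m) *
              hit_density (t - s) (B * ((m * s - p) / A + sqrt s / A * z) + q) (- n))
            \<le> ennreal (E * (s powr (- (1/2)) + 1)) * ennreal ((1 + \<bar>z\<bar>)\<^sup>2 * normal_density 0 (sqrt 2) z)"
          unfolding eq eq2 using ennreal_leI[OF le]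
          by (simp only: ennreal_mult'[OF abs_ge_zero] ennreal_mult'[OF weight_nonneg])
      qed
      also have "\<dots> = ennreal (E * (s powr (- (1/2)) + 1)) * ennreal J"
        unfolding J_nn[symmetric] by (rule nn_integral_cmult) measurable
      also have "\<dots> = ennreal (E * J) * ennreal (indicator {0..t} s * (s powr (- (1/2)) + 1))"
      proof -
        have ind: "indicator {0..t} s * (s powr (- (1/2)) + 1) = s powr (- (1/2)) + 1"
          using s elim by simp
        show ?thesis unfolding ind ennreal_mult'[OF E] by (simp only: mult_ac)
      qed
      finally show ?thesis .
    next
      case False
      then have zero: "indicator {0..} b * indicator {0..\<theta> / 2 * t} s *
            (hit_density s (A * b + p) (- m) * hit_density (t - s) (B * b + q) (- n)) = (0 :: real)" for b
        \<comment> \<open>At \<open>s = 0\<close> the hitting density is \<open>0\<close> by the convention for division by \<open>0\<close>.\<close>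
        by (auto simp: indicator_def hit_density_def)
      show ?thesis unfolding zero by simp
    qed
    have "(\<integral>\<^sup>+s. \<integral>\<^sup>+b. ennreal (indicator {0..} b * indicator {0..\<theta> / 2 * t} s *
            (hit_density s (A * b + p) (- m) * hit_density (t - s) (B * b + q) (- n))) \<partial>lborel \<partial>lborel)
        \<le> (\<integral>\<^sup>+s. ennreal (E * J) * ennreal (indicator {0..t} s * (s powr (- (1/2)) + 1)) \<partial>lborel)"
      by (rule nn_integral_mono) (rule inner)
    also have "\<dots> = ennreal (E * J) * ennreal (2 * sqrt t + t)"
      by (subst nn_integral_cmult) (use nn_integral_inverse_sqrt[of t] elim in auto)
    also have "\<dots> = ennreal (C * J * (t * exp (- \<kappa> * t) * (2 * sqrt t + t)))"
    proof -
      have eq: "C * J * (t * exp (- \<kappa> * t) * (2 * sqrt t + t)) = (E * J) * (2 * sqrt t + t)"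
        by (simp add: E_def mult_ac)
      have "0 \<le> E * J" using E J by simp
      then show ?thesis unfolding eq by (rule ennreal_mult'[symmetric])
    qed
    finally show ?case .
  qed
  have bound_lim: "((\<lambda>t. ennreal (C * J * (t * exp (- \<kappa> * t) * (2 * sqrt t + t)))) \<longlongrightarrow> 0) at_top"
  proof -
    have "((\<lambda>t. t * exp (- \<kappa> * t) * (2 * sqrt t + t)) \<longlongrightarrow> 0) at_top"
      using \<kappa> by real_asymp
    from tendsto_ennrealI[OF tendsto_mult_left[OF this, of "C * J"]] show ?thesis by simp
  qed
  show ?thesis
    by (rule tendsto_sandwich[OF _ bound tendsto_const bound_lim]) simp
qed

section \<open>The renewal limit\<close>

text \<open>The limit is the reciprocal of the mean increase \<open>A / m + B / n\<close> of the total hitting time per unit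
of \<open>b\<close>. The closed time intervals that define the three regions overlap at their end points, hence the
squeeze between the typical part and the sum of all three parts. Working with nonnegative integrals
first makes the order of integration irrelevant; finiteness, and with it the passage to the iterated
Lebesgue integral, holds for large \<open>t\<close> because the limit is finite.\<close>

lemma two_sided_renewal_tendsto:
  fixes A B m n p q :: real
  assumes A: "0 < A" and B: "0 < B" and m: "0 < m" and n: "0 < n"
  shows "((\<lambda>t. LINT b:{0..}|lborel. LINT s:{0..t}|lborel.
            hit_density s (A * b + p) (- m) * hit_density (t - s) (B * b + q) (- n))
          \<longlongrightarrow> m * n / (A * n + B * m)) at_top"
proof -
  define D where "D = A * n + B * m"
  define \<theta> where "\<theta> = A * n / D"
  have D: "0 < D" using assms by (simp add: D_def add_pos_pos)
  have \<theta>: "0 < \<theta>" "\<theta> < 1"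
    using assms D by (simp_all add: \<theta>_def field_simps) (simp add: D_def)
  have \<theta>': "B * m / (B * m + A * n) = 1 - \<theta>"
    using D by (simp add: \<theta>_def D_def field_simps)
  define h where "h = (\<lambda>t b s. hit_density s (A * b + p) (- m) * hit_density (t - s) (B * b + q) (- n))"
  define H where "H = (\<lambda>I t z. indicator {0..} (fst z) * indicator I (snd z) * h t (fst z) (snd z))"
  define N where "N = (\<lambda>I t. \<integral>\<^sup>+s. \<integral>\<^sup>+b. ennreal (H I t (b, s)) \<partial>lborel \<partial>lborel)"
  have H_meas [measurable]: "H {a..c} t \<in> borel_measurable (borel \<Otimes>\<^sub>M borel)" for a c t
    unfolding H_def h_def by measurable
  have H_meas': "H {a..c} t \<in> borel_measurable (lborel \<Otimes>\<^sub>M lborel)" for a c t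
    by measurable
  have H_nonneg: "0 \<le> H {0..t} t z" for t z
    by (auto simp: H_def h_def indicator_def intro!: mult_nonneg_nonneg hit_density_nonneg)

  have near: "((\<lambda>t. N {\<theta> / 2 * t..(1 + \<theta>) / 2 * t} t) \<longlongrightarrow> ennreal (m * n / D)) at_top"
    using typical_region_tendsto[OF A B m n, of p q] by (simp add: N_def H_def h_def \<theta>_def D_def)
  have far_left: "((\<lambda>t. N {0..\<theta> / 2 * t} t) \<longlongrightarrow> 0) at_top"
    using atypical_region_tendsto_0[OF A B m n, of p q] by (simp add: N_def H_def h_def \<theta>_def D_def)
  \<comment> \<open>Reversing time, \<open>s\<close> to \<open>t - s\<close>, exchanges the two motions and replaces \<open>\<theta>\<close> by \<open>1 - \<theta>\<close>.\<close>
  have far_right: "((\<lambda>t. N {(1 + \<theta>) / 2 * t..t} t) \<longlongrightarrow> 0) at_top"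
  proof -
    have "N {(1 + \<theta>) / 2 * t..t} t = (\<integral>\<^sup>+s. \<integral>\<^sup>+b. ennreal (indicator {0..} b * indicator {0..(1 - \<theta>) / 2 * t} s *
            (hit_density s (B * b + q) (- n) * hit_density (t - s) (A * b + p) (- m))) \<partial>lborel \<partial>lborel)" for t
    proof -
      have "N {(1 + \<theta>) / 2 * t..t} t =
        ennreal \<bar>- 1\<bar> * (\<integral>\<^sup>+s. \<integral>\<^sup>+b. ennreal (H {(1 + \<theta>) / 2 * t..t} t (b, t + (- 1) * s)) \<partial>lborel \<partial>lborel)"
        unfolding N_def by (rule nn_integral_real_affine) measurable
      also have "\<dots> = (\<integral>\<^sup>+s. \<integral>\<^sup>+b. ennreal (indicator {0..} b * indicator {0..(1 - \<theta>) / 2 * t} s *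
            (hit_density s (B * b + q) (- n) * hit_density (t - s) (A * b + p) (- m))) \<partial>lborel \<partial>lborel)"
      proof -
        have "indicator {(1 + \<theta>) / 2 * t..t} (t - s) = (indicator {0..(1 - \<theta>) / 2 * t} s :: real)" for s
          by (auto simp: indicator_def field_simps)
        then show ?thesis by (simp add: H_def h_def mult.commute[of "hit_density _ (A * _ + p) _"])
      qed
      finally show ?thesis .
    qed
    then show ?thesis using atypical_region_tendsto_0[OF B A n m, of q p] by (simp add: \<theta>')
  qed
  have N_lim: "((\<lambda>t. N {0..t} t) \<longlongrightarrow> ennreal (m * n / D)) at_top"
  proof (rule tendsto_sandwich[OF _ _ near])
    show "((\<lambda>t. N {0..\<theta> / 2 * t} t + N {\<theta> / 2 * t..(1 + \<theta>) / 2 * t} t + N {(1 + \<theta>) / 2 * t..t} t)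
        \<longlongrightarrow> ennreal (m * n / D)) at_top"
      using tendsto_add[OF tendsto_add[OF far_left near] far_right] by simp
    show "\<forall>\<^sub>F t in at_top. N {\<theta> / 2 * t..(1 + \<theta>) / 2 * t} t \<le> N {0..t} t"
      using eventually_gt_at_top[of 0]
    proof eventually_elim
      case (elim t)
      have "{\<theta> / 2 * t..(1 + \<theta>) / 2 * t} \<subseteq> {0..t}" using \<theta> elim by (auto intro: order_trans)
      then have "H {\<theta> / 2 * t..(1 + \<theta>) / 2 * t} t z \<le> H {0..t} t z" for z
      proof (cases "snd z \<in> {\<theta> / 2 * t..(1 + \<theta>) / 2 * t}")
        case True
        with \<open>{\<theta> / 2 * t..(1 + \<theta>) / 2 * t} \<subseteq> {0..t}\<close> have "snd z \<in> {0..t}" by blast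
        with True show ?thesis by (simp only: H_def indicator_simps)
      next
        case False
        then have "H {\<theta> / 2 * t..(1 + \<theta>) / 2 * t} t z = 0" by (simp add: H_def del: atLeastAtMost_iff)
        then show ?thesis using H_nonneg[of t z] by simp
      qed
      then show ?case unfolding N_def by (intro nn_integral_mono ennreal_leI)
    qed
    show "\<forall>\<^sub>F t in at_top. N {0..t} t \<le> N {0..\<theta> / 2 * t} t + N {\<theta> / 2 * t..(1 + \<theta>) / 2 * t} t + N {(1 + \<theta>) / 2 * t..t} t"
    proof (intro always_eventually allI)
      fix t
      have "ennreal (H {0..t} t z) \<le> ennreal (H {0..\<theta> / 2 * t} t z) + ennreal (H {\<theta> / 2 * t..(1 + \<theta>) / 2 * t} t z)
          + ennreal (H {(1 + \<theta>) / 2 * t..t} t z)" for z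
      proof (cases "snd z \<in> {0..t}")
        case True
        then consider "snd z \<in> {0..\<theta> / 2 * t}" | "snd z \<in> {\<theta> / 2 * t..(1 + \<theta>) / 2 * t}" | "snd z \<in> {(1 + \<theta>) / 2 * t..t}"
          by fastforce
        then show ?thesis
          by cases (use True in \<open>simp_all add: H_def add_increasing add_increasing2\<close>)
      qed (simp add: H_def)
      then have "N {0..t} t \<le> (\<integral>\<^sup>+s. \<integral>\<^sup>+b. ennreal (H {0..\<theta> / 2 * t} t (b, s)) + ennreal (H {\<theta> / 2 * t..(1 + \<theta>) / 2 * t} t (b, s))
          + ennreal (H {(1 + \<theta>) / 2 * t..t} t (b, s)) \<partial>lborel \<partial>lborel)"
        unfolding N_def by (intro nn_integral_mono)
      also have "\<dots> = N {0..\<theta> / 2 * t} t + N {\<theta> / 2 * t..(1 + \<theta>) / 2 * t} t + N {(1 + \<theta>) / 2 * t..t} t"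
        unfolding N_def by (subst nn_integral_add, measurable)+
      finally show "N {0..t} t \<le> N {0..\<theta> / 2 * t} t + N {\<theta> / 2 * t..(1 + \<theta>) / 2 * t} t + N {(1 + \<theta>) / 2 * t..t} t" .
    qed
  qed
  have "\<forall>\<^sub>F t in at_top. enn2real (N {0..t} t) = (LINT b:{0..}|lborel. LINT s:{0..t}|lborel. h t b s)"
    using order_tendstoD(2)[OF N_lim, of top, simplified]
  proof eventually_elim
    case (elim t)
    have "N {0..t} t = (\<integral>\<^sup>+b. \<integral>\<^sup>+s. ennreal (H {0..t} t (b, s)) \<partial>lborel \<partial>lborel)"
      unfolding N_def by (rule lborel_pair.Fubini') measurable
    also have "\<dots> = (\<integral>\<^sup>+z. ennreal (H {0..t} t z) \<partial>(lborel \<Otimes>\<^sub>M lborel))"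
      by (rule lborel.nn_integral_fst) measurable
    finally have N: "N {0..t} t = (\<integral>\<^sup>+z. ennreal (H {0..t} t z) \<partial>(lborel \<Otimes>\<^sub>M lborel))" .
    have int: "integrable (lborel \<Otimes>\<^sub>M lborel) (H {0..t} t)"
      by (rule integrableI_nonneg[OF H_meas']) (use H_nonneg elim N in auto)
    have "enn2real (N {0..t} t) = (\<integral>z. H {0..t} t z \<partial>(lborel \<Otimes>\<^sub>M lborel))"
      unfolding N by (rule integral_eq_nn_integral[OF H_meas', symmetric]) (use H_nonneg in auto)
    also have "\<dots> = (\<integral>b. \<integral>s. H {0..t} t (b, s) \<partial>lborel \<partial>lborel)"
      by (rule lborel_pair.integral_fst'[OF int, symmetric])
    also have "\<dots> = (LINT b:{0..}|lborel. LINT s:{0..t}|lborel. h t b s)"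
      by (simp add: set_lebesgue_integral_def H_def mult.assoc)
    finally show ?case .
  qed
  moreover have "((\<lambda>t. enn2real (N {0..t} t)) \<longlongrightarrow> m * n / D) at_top"
    by (rule tendsto_enn2real[OF N_lim]) (use D m n in simp)
  ultimately have "((\<lambda>t. LINT b:{0..}|lborel. LINT s:{0..t}|lborel. h t b s) \<longlongrightarrow> m * n / D) at_top"
    by (rule Lim_transform_eventually[rotated])
  then show ?thesis by (simp only: h_def D_def)
qed

section \<open>Convergence of the explicit density\<close>

lemma stationary_weight_factor:
  fixes k a b d e :: real
  shows "- 2 * k * a * b / d * e = 2 * k * e * (- a * b / d)"
  by (simp add: divide_inverse mult_ac)

lemma drift_kernel_difference_tendsto_0:
  "((\<lambda>t. drift_kernel t y \<mu> - c * drift_kernel t z \<mu>) \<longlongrightarrow> 0) at_top"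
  using tendsto_diff[OF drift_kernel_tendsto_0[of y \<mu>] tendsto_mult_left[OF drift_kernel_tendsto_0[of z \<mu>], of c]]
  by simp

text \<open>All sign cases of \<open>x\<close> and \<open>y\<close> are instances of one renewal limit: the variable \<open>\<tau>\<close> of the explicit formula
belongs to the motion on the half-line opposite to \<open>x\<close> when \<open>x\<close> and \<open>y\<close> are on the same side, and to
the motion that carries \<open>y\<close> otherwise. The starting points \<open>x\<close> and \<open>y\<close> enter only through
the shifts, on which the limit does not depend.\<close>

lemma rsbm_density_tendsto_pos:
  assumes \<beta>: "-1 < \<beta>" "\<beta> < 1" and m: "0 < \<mu>m" and p: "\<mu>p < 0" and y: "0 < y"
  shows "((\<lambda>t. rsbm_density \<beta> \<mu>p \<mu>m t x y) \<longlongrightarrow>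
    - 2 * (1 + \<beta>) * \<mu>p * \<mu>m / ((1 + \<beta>) * \<mu>m - (1 - \<beta>) * \<mu>p) * exp (2 * \<mu>p * y)) at_top"
proof -
  define c where "c = 2 * (1 + \<beta>) * exp (2 * \<mu>p * y)"
  define l where "l = - \<mu>p * \<mu>m / ((1 + \<beta>) * \<mu>m - (1 - \<beta>) * \<mu>p)"
  have lim: "- 2 * (1 + \<beta>) * \<mu>p * \<mu>m / ((1 + \<beta>) * \<mu>m - (1 - \<beta>) * \<mu>p) * exp (2 * \<mu>p * y) = c * l"
    unfolding c_def l_def by (rule stationary_weight_factor)
  show ?thesis
  proof (cases "x \<ge> 0")
    case True
    have "((\<lambda>t. LINT b:{0..}|lborel. LINT \<tau>:{0..t}|lborel.
        hit_density (t - \<tau>) ((1 + \<beta>) * b + x + y) \<mu>p * hit_density \<tau> ((1 - \<beta>) * b) (- \<mu>m)) \<longlongrightarrow> l) at_top"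
      using two_sided_renewal_tendsto[of "1 - \<beta>" "1 + \<beta>" \<mu>m "- \<mu>p" 0 "x + y"] assms
      by (simp add: l_def mult.commute[of "hit_density _ ((1 - \<beta>) * _) _"] add.assoc) (simp add: algebra_simps)
    from tendsto_add[OF drift_kernel_difference_tendsto_0[of "y - x" \<mu>p "exp (- 2 * \<mu>p * x)" "x + y"] tendsto_mult_left[OF this, of c]]
    show ?thesis
      unfolding lim using True y by (simp only: rsbm_density_def c_def if_True if_False add_0)
  next
    case False
    have "((\<lambda>t. LINT b:{0..}|lborel. LINT \<tau>:{0..t}|lborel.
        hit_density \<tau> ((1 + \<beta>) * b + y) \<mu>p * hit_density (t - \<tau>) ((1 - \<beta>) * b - x) (- \<mu>m)) \<longlongrightarrow> l) at_top"
      using two_sided_renewal_tendsto[of "1 + \<beta>" "1 - \<beta>" "- \<mu>p" \<mu>m y "- x"] assms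
      by (simp add: l_def)
    from tendsto_mult_left[OF this, of c] show ?thesis using False y
      unfolding rsbm_density_def lim by (simp add: c_def)
  qed
qed

lemma rsbm_density_tendsto_neg:
  assumes \<beta>: "-1 < \<beta>" "\<beta> < 1" and m: "0 < \<mu>m" and p: "\<mu>p < 0" and y: "y < 0"
  shows "((\<lambda>t. rsbm_density \<beta> \<mu>p \<mu>m t x y) \<longlongrightarrow>
    - 2 * (1 - \<beta>) * \<mu>p * \<mu>m / ((1 + \<beta>) * \<mu>m - (1 - \<beta>) * \<mu>p) * exp (2 * \<mu>m * y)) at_top"
proof -
  define c where "c = 2 * (1 - \<beta>) * exp (2 * \<mu>m * y)"
  define l where "l = - \<mu>p * \<mu>m / ((1 + \<beta>) * \<mu>m - (1 - \<beta>) * \<mu>p)"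
  have lim: "- 2 * (1 - \<beta>) * \<mu>p * \<mu>m / ((1 + \<beta>) * \<mu>m - (1 - \<beta>) * \<mu>p) * exp (2 * \<mu>m * y) = c * l"
    unfolding c_def l_def by (rule stationary_weight_factor)
  have "\<not> 0 < y" using y by simp
  show ?thesis
  proof (cases "x > 0")
    case True
    have "((\<lambda>t. LINT b:{0..}|lborel. LINT \<tau>:{0..t}|lborel.
        hit_density (t - \<tau>) ((1 + \<beta>) * b + x) \<mu>p * hit_density \<tau> ((1 - \<beta>) * b - y) (- \<mu>m)) \<longlongrightarrow> l) at_top"
      using two_sided_renewal_tendsto[of "1 - \<beta>" "1 + \<beta>" \<mu>m "- \<mu>p" "- y" x] assms
      by (simp add: l_def mult.commute[of "hit_density _ ((1 - \<beta>) * _ - y) _"]) (simp add: algebra_simps)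
    from tendsto_mult_left[OF this, of c] show ?thesis using True y
      unfolding rsbm_density_def lim by (simp add: c_def)
  next
    case False
    have "((\<lambda>t. LINT b:{0..}|lborel. LINT \<tau>:{0..t}|lborel.
        hit_density \<tau> ((1 + \<beta>) * b) \<mu>p * hit_density (t - \<tau>) ((1 - \<beta>) * b - y - x) (- \<mu>m)) \<longlongrightarrow> l) at_top"
      using two_sided_renewal_tendsto[of "1 + \<beta>" "1 - \<beta>" "- \<mu>p" \<mu>m 0 "- y - x"] assms
      by (simp add: l_def add_diff_eq)
    from tendsto_add[OF drift_kernel_difference_tendsto_0[of "y - x" \<mu>m "exp (2 * \<mu>m * y)" "- x - y"] tendsto_mult_left[OF this, of c]]
    show ?thesis
      unfolding lim using False \<open>\<not> 0 < y\<close> by (simp only: rsbm_density_def c_def if_True if_False add_0)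
  qed
qed

theorem proposition6:
  fixes M :: "'w measure" and F :: "real \<Rightarrow> 'w measure" and B X :: "real \<Rightarrow> 'w \<Rightarrow> real"
    and p :: "real \<Rightarrow> real \<Rightarrow> real \<Rightarrow> real" and \<beta> \<mu>p \<mu>m x :: real
  assumes "-1 < \<beta>" and "\<beta> < 1" and "\<mu>m > 0" and "\<mu>p < 0"
    and "refracted_skew_bm M F B \<beta> \<mu>p \<mu>m 0 X"
    and "AE \<omega> in M. X 0 \<omega> = x"
    and "\<And>t. t > 0 \<Longrightarrow> distributed M lborel (X t) (\<lambda>y. ennreal (p t x y))"
    and "\<And>t y. t > 0 \<Longrightarrow> y \<noteq> 0 \<Longrightarrow> p t x y = rsbm_density \<beta> \<mu>p \<mu>m t x y"
  shows "(\<forall>y>0. ((\<lambda>t. p t x y) \<longlongrightarrow>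
             - 2 * (1 + \<beta>) * \<mu>p * \<mu>m / ((1 + \<beta>) * \<mu>m - (1 - \<beta>) * \<mu>p) * exp (2 * \<mu>p * y)) at_top) \<and>
         (\<forall>y<0. ((\<lambda>t. p t x y) \<longlongrightarrow>
             - 2 * (1 - \<beta>) * \<mu>p * \<mu>m / ((1 + \<beta>) * \<mu>m - (1 - \<beta>) * \<mu>p) * exp (2 * \<mu>m * y)) at_top)"
proof -
  have p_eq: "\<forall>\<^sub>F t in at_top. rsbm_density \<beta> \<mu>p \<mu>m t x y = p t x y" if "y \<noteq> 0" for y
    using eventually_gt_at_top[of 0] by eventually_elim (use assms(8) that in simp)
  show ?thesis
  proof (intro conjI allI impI)
    fix y :: real
    assume "0 < y"
    with p_eq[of y] show "((\<lambda>t. p t x y) \<longlongrightarrow>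
        - 2 * (1 + \<beta>) * \<mu>p * \<mu>m / ((1 + \<beta>) * \<mu>m - (1 - \<beta>) * \<mu>p) * exp (2 * \<mu>p * y)) at_top"
      by (intro Lim_transform_eventually[OF rsbm_density_tendsto_pos[OF assms(1-4)]]) auto
  next
    fix y :: real
    assume "y < 0"
    with p_eq[of y] show "((\<lambda>t. p t x y) \<longlongrightarrow>
        - 2 * (1 - \<beta>) * \<mu>p * \<mu>m / ((1 + \<beta>) * \<mu>m - (1 - \<beta>) * \<mu>p) * exp (2 * \<mu>m * y)) at_top"
      by (intro Lim_transform_eventually[OF rsbm_density_tendsto_neg[OF assms(1-4)]]) auto
  qed
qed

end
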